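(* Let $n\ge1$ and let $\mathbb Z^n$ be the free abelian group of rank $n$. Then $\mathscr C(\mathbb Z^n)=\operatorname{Aut}(\mathbb Z^n)=\operatorname{GL}(n,\mathbb Z)$, where the automorphisms of $\mathbb Z^n$ are identified with the invertible $n\times n$ integer matrices in the usual way.
   Context: For a semigroup (in particular a group, written additively or multiplicatively) $S$, an involution of $S$ is a bijection $\alpha:S\to S$ with $\alpha(xy)=\alpha(y)\alpha(x)$ for all $x,y\in S$ and $\alpha^2=\mathrm{id}_S\neq\alpha$. $I(S)$ is the set of all involutions of $S$ and $\mathscr C(S)=\langle I(S)\rangle$ is the subgroup of $\operatorname{Sym}(S)$ generated by $I(S)$. $\operatorname{GL}(n,\mathbb Z)$ is the group of $n\times n$ integer matrices with determinant $\pm1$. *)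

theory Defs
  imports "HOL-Analysis.Determinants" "HOL-Algebra.Bij" "HOL-Algebra.Generated_Groups"
begin

text \<open>
  Following the conventions of \<^const>\<open>Bij\<close> and \<^const>\<open>BijGroup\<close>, a self-map of \<open>carrier S\<close> is
  represented by its extensional version, so the identity of \<open>S\<close> is \<open>\<lambda>x\<in>carrier S. x\<close>.
\<close>

definition involutions :: "('a, 'm) monoid_scheme \<Rightarrow> ('a \<Rightarrow> 'a) set" where
  "involutions S =
     {\<alpha> \<in> Bij (carrier S).
        (\<forall>x\<in>carrier S. \<forall>y\<in>carrier S. \<alpha> (x \<otimes>\<^bsub>S\<^esub> y) = \<alpha> y \<otimes>\<^bsub>S\<^esub> \<alpha> x) \<and>
        compose (carrier S) \<alpha> \<alpha> = (\<lambda>x\<in>carrier S. x) \<and>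
        \<alpha> \<noteq> (\<lambda>x\<in>carrier S. x)}"

definition involution_subgroup :: "('a, 'm) monoid_scheme \<Rightarrow> ('a \<Rightarrow> 'a) set" where
  "involution_subgroup S = generate (BijGroup (carrier S)) (involutions S)"

text \<open>
  The rank is the cardinality of the index type \<open>'n\<close>; it is automatically at least 1.
\<close>

definition int_vec_group :: "(int ^ 'n::finite) monoid" where
  "int_vec_group = \<lparr>carrier = UNIV, mult = (+), one = 0\<rparr>"

definition GL_int :: "(int ^ 'n::finite ^ 'n) monoid" where
  "GL_int = \<lparr>carrier = {A. det A = 1 \<or> det A = - 1}, mult = (**), one = mat 1\<rparr>"

end

theory Submission imports Defs begin

text \<open>
  An integer matrix of determinant \<open>\<plusminus>1\<close> is reduced to the identity by Euclid's algorithm, column by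
  column. All row operations are carried out by the reflections \<open>row_reflection k c\<close>, which negate
  row \<open>k\<close> and add multiples of it to the other rows; they square to the identity, so the matrix
  is a product of involutions. This also yields its invertibility, without adjugates.
\<close>

section \<open>Row reflections and products of involutory matrices\<close>

definition row_reflection :: "'n \<Rightarrow> ('n \<Rightarrow> 'a) \<Rightarrow> 'a::comm_ring_1 ^ 'n::finite ^ 'n" where
  "row_reflection k c =
     (\<chi> i j. (if i = j then if i = k then -1 else 1 else 0) + (if j = k \<and> i \<noteq> k then c i else 0))"

lemma row_reflection_mult_nth:
  "(row_reflection k c ** A) $ i $ j = (if i = k then - A $ k $ j else A $ i $ j + c i * A $ k $ j)"
proof -
  have "(row_reflection k c ** A) $ i $ j =
      (\<Sum>m\<in>UNIV. (if i = m then (if i = k then -1 else 1) * A $ m $ j else 0)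
        + (if m = k then (if i = k then 0 else c i) * A $ m $ j else 0))"
    unfolding matrix_matrix_mult_def row_reflection_def
    by (simp only: vec_lambda_beta, rule sum.cong) (auto simp: algebra_simps)
  also have "\<dots> = (if i = k then - A $ k $ j else A $ i $ j + c i * A $ k $ j)"
    by (simp add: sum.distrib)
  finally show ?thesis .
qed

text \<open>The second application adds \<open>c i\<close> times the negated row \<open>k\<close>,
  which undoes the first.\<close>

lemma row_reflection_square: "row_reflection k c ** row_reflection k c = mat 1"
  by (simp add: vec_eq_iff row_reflection_mult_nth) (simp add: row_reflection_def mat_def)

inductive_set involution_products :: "(int ^ 'n::finite ^ 'n) set" where
  one: "mat 1 \<in> involution_products"
| mult: "T ** T = mat 1 \<Longrightarrow> A \<in> involution_products \<Longrightarrow> T ** A \<in> involution_products"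

text \<open>Lets the reduction run forwards: after a row operation, only the simpler matrix remains
  to be factored.\<close>

lemma involution_products_cancel:
  assumes "T ** T = mat 1" "T ** A \<in> involution_products"
  shows "A \<in> involution_products"
proof -
  have "T ** (T ** A) = A" by (simp add: matrix_mul_assoc assms(1))
  then show ?thesis using involution_products.mult[OF assms] by simp
qed

section \<open>Units and divisibility of determinants\<close>

lemma is_unit_det_of_mult_eq_mat_1:
  fixes A B :: "'a::{comm_ring_1,algebraic_semidom} ^ 'n::finite ^ 'n"
  assumes "A ** B = mat 1"
  shows "is_unit (det A)" "is_unit (det B)"
proof -
  have "1 = det A * det B" by (metis assms det_I det_mul)
  then show "is_unit (det A)" "is_unit (det B)" by (metis dvd_triv_left dvd_triv_right)+
qed

lemma is_unit_det_involution_mult_iff: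
  fixes A T :: "'a::{comm_ring_1,algebraic_semidom} ^ 'n::finite ^ 'n"
  assumes "T ** T = mat 1"
  shows "is_unit (det (T ** A)) \<longleftrightarrow> is_unit (det A)"
  using is_unit_det_of_mult_eq_mat_1[OF assms] by (simp add: det_mul is_unit_mult_iff)

text \<open>In the Leibniz expansion, a permutation moving an index outside \<open>K\<close> picks a
  zero of a standard column; any other one maps \<open>K\<close> to itself and contributes a factor
  \<open>A $ p k $ k\<close> divisible by \<open>d\<close>. Entries of column \<open>k\<close> in
  rows outside \<open>K\<close> may thus be arbitrary.\<close>

lemma dvd_det_of_partial_column:
  fixes A :: "'a::comm_ring_1 ^ 'n::finite ^ 'n"
  assumes std: "\<And>i j. j \<notin> K \<Longrightarrow> A $ i $ j = (if i = j then 1 else 0)"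
    and "k \<in> K" and d: "\<And>i. i \<in> K \<Longrightarrow> d dvd A $ i $ k"
  shows "d dvd det A"
proof -
  have "d dvd of_int (sign p) * (\<Prod>j\<in>UNIV. A $ p j $ j)" if p: "p permutes UNIV" for p :: "'n \<Rightarrow> 'n"
  proof (cases "\<forall>j. j \<notin> K \<longrightarrow> p j = j")
    case True
    \<comment> \<open>If \<open>p k\<close> lay outside \<open>K\<close>, it would be fixed, and
      injectivity would give \<open>p k = k\<close>.\<close>
    have "p k \<in> K"
      using True permutes_inj[OF p] \<open>k \<in> K\<close> by (metis injD)
    then have "d dvd A $ p k $ k" by (rule d)
    moreover have "A $ p k $ k dvd (\<Prod>j\<in>UNIV. A $ p j $ j)"
      by (rule dvd_prodI) auto
    ultimately show ?thesis by (meson dvd_mult dvd_trans)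
  next
    case False
    then obtain j where "j \<notin> K" "p j \<noteq> j" by blast
    then have "(\<Prod>j\<in>UNIV. A $ p j $ j) = 0"
      by (simp add: prod.remove[of _ j] std)
    then show ?thesis by simp
  qed
  \<comment> \<open>The expansion by columns is the one that \<open>det_def\<close> gives for the
    transpose.\<close>
  then have "d dvd det (transpose A)"
    unfolding det_def by (intro dvd_sum) (auto simp: transpose_def)
  then show ?thesis by simp
qed

section \<open>Euclidean reduction of integer matrices\<close>

text \<open>A pivot \<open>-1\<close> lets one reflection finish column \<open>k\<close>: negation
  turns the pivot into 1, and adding \<open>A $ i $ k\<close> times row \<open>k\<close> clears
  every other row. The columns already standard survive because row \<open>k\<close> vanishes
  there.\<close>

lemma involution_products_if_pivot:
  fixes A :: "int ^ 'n::finite ^ 'n"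
  assumes step: "\<And>B. is_unit (det B) \<Longrightarrow>
      (\<And>i j. j \<notin> F \<Longrightarrow> B $ i $ j = (if i = j then 1 else 0)) \<Longrightarrow> B \<in> involution_products"
    and unit: "is_unit (det A)"
    and std: "\<And>i j. j \<notin> insert k F \<Longrightarrow> A $ i $ j = (if i = j then 1 else 0)"
    and pivot: "A $ k $ k = -1"
  shows "A \<in> involution_products"
proof (rule involution_products_cancel)
  let ?T = "row_reflection k (\<lambda>i. A $ i $ k)"
  show "?T ** ?T = mat 1" by (rule row_reflection_square)
  show "?T ** A \<in> involution_products"
  proof (rule step)
    show "is_unit (det (?T ** A))"
      using unit is_unit_det_involution_mult_iff[OF row_reflection_square] by blast
    show "(?T ** A) $ i $ j = (if i = j then 1 else 0)" if "j \<notin> F" for i j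
      using that std[of j] pivot by (cases "j = k") (auto simp: row_reflection_mult_nth)
  qed
qed

lemma row_reflection_mult_std_column:
  assumes "\<And>i. A $ i $ j = (if i = j then 1 else 0)" "j \<noteq> l"
  shows "(row_reflection l c ** A) $ i $ j = (if i = j then 1 else 0)"
  using assms by (auto simp: row_reflection_mult_nth)

text \<open>One subtractive Euclidean step: the signs are matched so that the left side is
  \<open>\<bar>a\<bar> - \<bar>b\<bar>\<close>.\<close>

lemma abs_add_sgn_mult_less:
  fixes a b :: int
  assumes "b \<noteq> 0" "\<bar>b\<bar> \<le> \<bar>a\<bar>"
  shows "\<bar>a + - (sgn a * sgn b) * b\<bar> < \<bar>a\<bar>"
  using assms by (auto simp: sgn_if)

lemma involution_products_if_is_unit_det:
  fixes A :: "int ^ 'n::finite ^ 'n"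
  assumes "is_unit (det A)"
  shows "A \<in> involution_products"
proof -
  \<comment> \<open>Generalized for induction: \<open>K\<close> contains the indices of all columns
    that may still be nonstandard.\<close>
  have "A \<in> involution_products"
    if "is_unit (det A)" "\<And>i j. j \<notin> K \<Longrightarrow> A $ i $ j = (if i = j then 1 else 0)" "finite K" for A and K :: "'n set"
    using that(3,1,2)
  proof (induction K arbitrary: A rule: finite_induct)
    case empty
    then have "A = mat 1" by (auto simp: vec_eq_iff mat_def)
    then show ?case by (simp add: involution_products.one)
  next
    case (insert k F)
    let ?K = "insert k F"
    show ?case
      using insert.prems
    \<comment> \<open>The measure sees only rows in \<open>?K\<close>. Reflecting at a row outside
      could spoil its standard column, and the entries there are cleared only at the pivot
      step.\<close>
    proof (induction "\<Sum>i\<in>?K. nat \<bar>A $ i $ k\<bar>" arbitrary: A rule: less_induct)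
      case less
      note unit = less.prems(1) and std = less.prems(2)
      note pivot = involution_products_if_pivot[of F _ k, OF insert.IH]
      have unit_reflect: "is_unit (det (row_reflection l c ** A))" for l c
        using unit unfolding is_unit_det_involution_mult_iff[OF row_reflection_square] .
      have std_reflect: "(row_reflection l c ** A) $ i $ j = (if i = j then 1 else 0)"
        if "l \<in> ?K" "j \<notin> ?K" for l c i j
      proof (rule row_reflection_mult_std_column)
        show "j \<noteq> l" using that by blast
      qed (rule std[OF that(2)])
      show ?case
      proof (cases "\<exists>i\<in>?K. \<exists>l\<in>?K. i \<noteq> l \<and> A $ l $ k \<noteq> 0 \<and> \<bar>A $ l $ k\<bar> \<le> \<bar>A $ i $ k\<bar>")
        case True
        then obtain i l where il: "i \<in> ?K" "l \<in> ?K" "i \<noteq> l" "A $ l $ k \<noteq> 0"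
          "\<bar>A $ l $ k\<bar> \<le> \<bar>A $ i $ k\<bar>" by blast
        \<comment> \<open>Only row \<open>i\<close> receives a multiple of row \<open>l\<close>. Row
          \<open>l\<close> itself is negated, which leaves its absolute values unchanged.\<close>
        let ?c = "\<lambda>m. if m = i then - (sgn (A $ i $ k) * sgn (A $ l $ k)) else 0"
        let ?B = "row_reflection l ?c ** A"
        have "(\<Sum>m\<in>?K. nat \<bar>?B $ m $ k\<bar>) < (\<Sum>m\<in>?K. nat \<bar>A $ m $ k\<bar>)"
        proof (rule sum_strict_mono_ex1)
          show "finite ?K" using insert.hyps by simp
          have lt: "\<bar>?B $ i $ k\<bar> < \<bar>A $ i $ k\<bar>"
            using il abs_add_sgn_mult_less[of "A $ l $ k" "A $ i $ k"]
            by (simp add: row_reflection_mult_nth)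
          then show "\<exists>m\<in>?K. nat \<bar>?B $ m $ k\<bar> < nat \<bar>A $ m $ k\<bar>"
            using il(1) by (intro bexI[of _ i]) auto
          have "\<bar>?B $ m $ k\<bar> \<le> \<bar>A $ m $ k\<bar>" for m
            using lt by (cases "m = i") (auto simp: row_reflection_mult_nth)
          then show "\<forall>m\<in>?K. nat \<bar>?B $ m $ k\<bar> \<le> nat \<bar>A $ m $ k\<bar>"
            by (simp add: nat_mono)
        qed
        then have "?B \<in> involution_products"
          by (rule less.hyps[OF _ unit_reflect std_reflect[OF il(2)]])
        then show ?thesis
          by (rule involution_products_cancel[OF row_reflection_square])
      next
        case False
        then have smaller: "\<bar>A $ i $ k\<bar> < \<bar>A $ l $ k\<bar>"
          if "i \<in> ?K" "l \<in> ?K" "i \<noteq> l" "A $ l $ k \<noteq> 0" for i l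
          using that by (meson not_le)
        \<comment> \<open>Otherwise the divisibility lemma with \<open>d = 0\<close> makes the
          determinant vanish.\<close>
        have "\<exists>l\<in>?K. A $ l $ k \<noteq> 0"
        proof (rule ccontr)
          assume "\<not> ?thesis"
          then have zero: "A $ i $ k = 0" if "i \<in> ?K" for i using that by blast
          have "0 dvd det A"
            by (rule dvd_det_of_partial_column[of ?K A k, OF std]) (simp_all add: zero)
          then show False using unit by simp
        qed
        then obtain l where l: "l \<in> ?K" "A $ l $ k \<noteq> 0" by blast
        \<comment> \<open>Two nonzero entries would each be strictly smaller than the other in
          absolute value.\<close>
        have zero: "A $ i $ k = 0" if "i \<in> ?K" "i \<noteq> l" for i
          using smaller[of i l] smaller[of l i] that l by fastforce
        have "A $ l $ k dvd det A"
        proof (rule dvd_det_of_partial_column[of ?K A k, OF std])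
          show "A $ l $ k dvd A $ i $ k" if "i \<in> ?K" for i
            using zero[OF that] by (cases "i = l") auto
        qed simp_all
        then have "is_unit (A $ l $ k)" using unit by (meson dvd_trans)
        then have u: "A $ l $ k = 1 \<or> A $ l $ k = -1" by auto
        show ?thesis
        proof (cases "A $ k $ k = -1")
          case True
          show ?thesis by (rule pivot[OF _ _ unit std True])
        next
          case no_pivot: False
          \<comment> \<open>If \<open>l = k\<close>, the pivot is 1 and gets negated. Otherwise it
            is 0 and becomes minus the square of the unit \<open>A $ l $ k\<close>, again
            \<open>-1\<close>.\<close>
          let ?B = "row_reflection l (\<lambda>i. - (A $ l $ k)) ** A"
          have "?B $ k $ k = -1"
            using u no_pivot zero[of k]
            by (cases "l = k") (auto simp: row_reflection_mult_nth)
          then have "?B \<in> involution_products"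
            by (intro pivot[OF _ _ unit_reflect std_reflect[OF l(1)]])
          then show ?thesis
            by (rule involution_products_cancel[OF row_reflection_square])
        qed
      qed
    qed
  qed
  from this[of A UNIV] show ?thesis using assms by simp
qed

section \<open>Additive maps between integer vectors as matrices\<close>

lemma of_nat_Suc_vector_smult:
  fixes v :: "'a::comm_ring_1 ^ 'n"
  shows "of_nat (Suc m) *s v = v + of_nat m *s v"
  by (simp add: vec_eq_iff algebra_simps)

text \<open>Additivity already forces compatibility with integer scalars, first natural, then
  negative ones. The map is then determined by the images of the standard basis, which form the
  columns of \<open>A\<close>.\<close>

lemma additive_int_vec_eq_matrix:
  fixes f :: "int ^ 'n::finite \<Rightarrow> int ^ 'm::finite"
  assumes add: "\<And>x y. f (x + y) = f x + f y"
  obtains A where "f = (*v) A"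
proof
  interpret f: additive f by unfold_locales (rule add)
  have f_nat: "f (of_nat m *s x) = of_nat m *s f x" for m x
  proof (induction m)
    case (Suc m)
    then show ?case by (simp only: of_nat_Suc_vector_smult add)
  qed (simp add: f.zero)
  have scale: "f (c *s x) = c *s f x" for c x
  proof (cases c rule: int_cases2)
    case (nonneg m)
    then show ?thesis using f_nat by simp
  next
    case (nonpos m)
    have "- int m *s x = - (int m *s x)" "- int m *s f x = - (int m *s f x)"
      by (simp_all add: vec_eq_iff)
    then show ?thesis using f_nat[of m x] by (simp add: nonpos f.minus)
  qed
  show "f = (*v) (\<chi> i j. f (axis j 1) $ i)"
  proof
    fix x
    have "f x = f (\<Sum>j\<in>UNIV. x $ j *s axis j 1)" by (simp add: basis_expansion)
    also have "\<dots> = (\<Sum>j\<in>UNIV. x $ j *s f (axis j 1))" by (simp add: f.sum scale)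
    also have "\<dots> = (\<chi> i j. f (axis j 1) $ i) *v x"
      by (simp add: vec_eq_iff matrix_vector_mult_def mult.commute)
    finally show "f x = (\<chi> i j. f (axis j 1) $ i) *v x" .
  qed
qed

section \<open>Automorphisms of the free abelian group\<close>

lemma carrier_int_vec_group [simp]: "carrier int_vec_group = UNIV"
  by (simp add: int_vec_group_def)

lemma mult_int_vec_group [simp]: "x \<otimes>\<^bsub>int_vec_group\<^esub> y = x + y"
  by (simp add: int_vec_group_def)

lemma group_int_vec_group: "group (int_vec_group :: (int ^ 'n::finite) monoid)"
  by (rule groupI) (auto simp: int_vec_group_def add.assoc intro: exI[of _ "- x" for x])

lemma Bij_UNIV: "f \<in> Bij UNIV \<longleftrightarrow> bij f"
  by (simp add: Bij_def extensional_UNIV)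

lemma compose_UNIV: "compose UNIV f g = f \<circ> g"
  by (simp add: compose_def fun_eq_iff)

lemma auto_int_vec_group_iff:
  "f \<in> auto (int_vec_group :: (int ^ 'n::finite) monoid) \<longleftrightarrow> bij f \<and> (\<forall>x y. f (x + y) = f x + f y)"
  by (auto simp: auto_def hom_def Bij_UNIV)

text \<open>From left to right, the inverse map is additive, hence a matrix inverse, and
  determinants multiply. Conversely, each factor in a product of involutory matrices is its own
  inverse.\<close>

lemma bij_matrix_vector_mult_iff:
  fixes A :: "int ^ 'n::finite ^ 'n"
  shows "bij ((*v) A) \<longleftrightarrow> is_unit (det A)"
proof
  assume bij: "bij ((*v) A)"
  let ?g = "inv_into UNIV ((*v) A)"
  have g: "A *v ?g x = x" for x
    using bij by (metis bij_is_surj surj_f_inv_f)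
  have "?g (x + y) = ?g x + ?g y" for x y
    using bij by (intro inv_f_eq) (simp_all add: bij_is_inj matrix_vector_right_distrib g)
  then obtain B where "?g = (*v) B" by (rule additive_int_vec_eq_matrix)
  then have "A ** B = mat 1"
    using g by (simp add: matrix_eq flip: matrix_vector_mul_assoc)
  then show "is_unit (det A)" by (rule is_unit_det_of_mult_eq_mat_1)
next
  assume "is_unit (det A)"
  then have "A \<in> involution_products" by (rule involution_products_if_is_unit_det)
  then show "bij ((*v) A)"
  proof induction
    case one
    show ?case by (rule o_bij[of id]) auto
  next
    case (mult T A)
    have "bij ((*v) T)"
      by (rule o_bij[of "(*v) T"]) (auto simp: fun_eq_iff matrix_vector_mul_assoc mult.hyps)
    with mult.IH have "bij ((*v) T \<circ> (*v) A)" by (rule bij_comp)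
    then show ?case by (simp add: comp_def matrix_vector_mul_assoc)
  qed
qed

lemma auto_int_vec_group_eq:
  "auto (int_vec_group :: (int ^ 'n::finite) monoid) = (*v) ` {A :: int ^ 'n ^ 'n. is_unit (det A)}"
proof (intro equalityI subsetI)
  fix f :: "int ^ 'n \<Rightarrow> int ^ 'n"
  assume "f \<in> auto int_vec_group"
  then have f: "bij f" "\<And>x y. f (x + y) = f x + f y" by (auto simp: auto_int_vec_group_iff)
  from f(2) obtain A where "f = (*v) A" by (rule additive_int_vec_eq_matrix)
  then show "f \<in> (*v) ` {A. is_unit (det A)}" using f(1) bij_matrix_vector_mult_iff by auto
next
  fix f :: "int ^ 'n \<Rightarrow> int ^ 'n"
  assume "f \<in> (*v) ` {A. is_unit (det A)}"
  then show "f \<in> auto int_vec_group"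
    by (auto simp: auto_int_vec_group_iff bij_matrix_vector_mult_iff matrix_vector_right_distrib)
qed

section \<open>The subgroup generated by involutions, and the identification with matrices\<close>

lemma mult_BijGroup_UNIV:
  "bij f \<Longrightarrow> bij g \<Longrightarrow> f \<otimes>\<^bsub>BijGroup UNIV\<^esub> g = f \<circ> g"
  by (simp add: BijGroup_def Bij_UNIV compose_UNIV)

lemma one_BijGroup_UNIV: "\<one>\<^bsub>BijGroup UNIV\<^esub> = id"
  by (simp add: BijGroup_def fun_eq_iff)

text \<open>Commutativity turns the reversed product rule into additivity.\<close>

lemma involutions_int_vec_group_iff:
  "f \<in> involutions (int_vec_group :: (int ^ 'n::finite) monoid) \<longleftrightarrow>
    f \<in> auto int_vec_group \<and> f \<circ> f = id \<and> f \<noteq> id"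
proof -
  have "(\<lambda>x. x) = id" by (simp add: fun_eq_iff)
  then show ?thesis
    by (auto simp: involutions_def auto_int_vec_group_iff Bij_UNIV compose_UNIV add.commute)
qed

text \<open>The automorphisms form a subgroup of the bijections containing all involutions.
  Conversely, the matrix of an automorphism factors into involutory matrices.\<close>

lemma involution_subgroup_int_vec_group:
  "involution_subgroup (int_vec_group :: (int ^ 'n::finite) monoid) = auto int_vec_group"
proof (intro equalityI subsetI)
  fix f :: "int ^ 'n \<Rightarrow> int ^ 'n"
  assume "f \<in> involution_subgroup int_vec_group"
  moreover have "involution_subgroup (int_vec_group :: (int ^ 'n) monoid) \<subseteq> auto int_vec_group"
    unfolding involution_subgroup_def
    by (rule group.generate_subgroup_incl[OF group_BijGroup])
      (auto simp: involutions_int_vec_group_iff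
        intro: group.subgroup_auto[OF group_int_vec_group, simplified])
  ultimately show "f \<in> auto int_vec_group" by blast
next
  fix f :: "int ^ 'n \<Rightarrow> int ^ 'n"
  assume "f \<in> auto int_vec_group"
  then obtain A :: "int ^ 'n ^ 'n" where f: "f = (*v) A" and "is_unit (det A)"
    by (auto simp: auto_int_vec_group_eq)
  then have "A \<in> involution_products" using involution_products_if_is_unit_det by blast
  \<comment> \<open>The unit determinant is carried along because multiplication in
    \<open>BijGroup\<close> is composition only on bijections.\<close>
  then have "is_unit (det A) \<and> (*v) A \<in> involution_subgroup int_vec_group"
  proof induction
    case one
    have "(*v) (mat 1 :: int ^ 'n ^ 'n) = id" by (simp add: fun_eq_iff)
    then show ?case
      by (metis carrier_int_vec_group det_I generate.one involution_subgroup_def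
          one_BijGroup_UNIV one_dvd)
  next
    case (mult T A)
    have T: "is_unit (det T)" using is_unit_det_of_mult_eq_mat_1[OF mult.hyps(1)] by blast
    have TA: "(*v) (T ** A) = (*v) T \<otimes>\<^bsub>BijGroup UNIV\<^esub> (*v) A"
      using T mult.IH by (simp add: mult_BijGroup_UNIV bij_matrix_vector_mult_iff fun_eq_iff
          matrix_vector_mul_assoc)
    have "(*v) T \<in> involution_subgroup int_vec_group"
    \<comment> \<open>A trivial factor is not an involution, but lies in the subgroup as its neutral
      element.\<close>
    proof (cases "(*v) T = id")
      case True
      then show ?thesis
        by (metis carrier_int_vec_group generate.one involution_subgroup_def one_BijGroup_UNIV)
    next
      case False
      have "(*v) T \<circ> (*v) T = id"
        by (simp add: fun_eq_iff matrix_vector_mul_assoc mult.hyps)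
      then have "(*v) T \<in> involutions int_vec_group"
        using False T by (auto simp: involutions_int_vec_group_iff auto_int_vec_group_eq)
      then show ?thesis unfolding involution_subgroup_def by (rule generate.incl)
    qed
    then have "(*v) (T ** A) \<in> involution_subgroup int_vec_group"
      using mult.IH unfolding TA involution_subgroup_def carrier_int_vec_group
      by (intro generate.eng) auto
    then show ?case using is_unit_det_involution_mult_iff[OF mult.hyps(1)] mult.IH by blast
  qed
  then show "f \<in> involution_subgroup int_vec_group" by (simp add: f)
qed

text \<open>A matrix is determined by its action on vectors, products act by composition, and every
  automorphism comes from a matrix with unit determinant.\<close>

lemma matrix_vector_mult_iso_GL_int:
  "(*v) \<in> iso (GL_int :: (int ^ 'n::finite ^ 'n) monoid) (AutoGroup int_vec_group)"
proof -
  have carrier: "carrier GL_int = {A :: int ^ 'n ^ 'n. is_unit (det A)}"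
    by (auto simp: GL_int_def)
  have "inj_on (*v) (carrier (GL_int :: (int ^ 'n ^ 'n) monoid))"
    by (rule inj_onI) (simp add: matrix_eq)
  moreover have "(*v) \<in> hom (GL_int :: (int ^ 'n ^ 'n) monoid) (AutoGroup int_vec_group)"
  proof (rule homI)
    fix A B :: "int ^ 'n ^ 'n"
    assume AB: "A \<in> carrier GL_int" "B \<in> carrier GL_int"
    then show "(*v) A \<in> carrier (AutoGroup int_vec_group)"
      by (simp add: carrier AutoGroup_def auto_int_vec_group_eq)
    have "(*v) (A ** B) = (*v) A \<otimes>\<^bsub>BijGroup UNIV\<^esub> (*v) B"
      using AB by (simp add: carrier mult_BijGroup_UNIV bij_matrix_vector_mult_iff fun_eq_iff
          matrix_vector_mul_assoc)
    then show "(*v) (A \<otimes>\<^bsub>GL_int\<^esub> B) = (*v) A \<otimes>\<^bsub>AutoGroup int_vec_group\<^esub> (*v) B"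
      by (simp add: AutoGroup_def GL_int_def)
  qed
  ultimately show ?thesis
    by (simp add: iso_def bij_betw_def carrier AutoGroup_def auto_int_vec_group_eq)
qed

theorem mainTheorem6:
  shows "involution_subgroup (int_vec_group :: (int ^ 'n::finite) monoid)
           = auto (int_vec_group :: (int ^ 'n) monoid)
       \<and> (\<lambda>A :: int ^ 'n ^ 'n. \<lambda>x :: int ^ 'n. A *v x)
           \<in> iso GL_int (AutoGroup int_vec_group)"
  using involution_subgroup_int_vec_group matrix_vector_mult_iso_GL_int by blast

end
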